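(* For the stochastic broadcast scheduling problem described in the context, the myopic policy generates expected total reward within a factor of $2$ of (i.e. at least one half of) that of the optimal adaptive policy.
   Context: Stochastic broadcast scheduling. There is a finite set of users $u\in\{1,\dots,U\}$ and a finite set of pages $i\in\{1,\dots,n\}$; time is discrete with horizon $T$. In every time slot a user may generate requests for pages he has not requested in the past. Each request $m=(u_m,i_m,\tau_m,d_m)$ consists of a user, a page, an arrival time $\tau_m$ and a deadline $d_m$. The arrivals of requests and their deadlines are governed by exogenous stochastic processes, with a known bound on the number of requests arriving in any slot. In each slot $t$ one chooses a single page and transmits it to a set of at most $k\ge1$ users. A user $u$ to whom a page is transmitted in slot $t$ receives it with probability $P_t^u\in[0,1]$, where $(P_t^u)_t$ is an exogenous stochastic process (with current value known at time $t$); given these probabilities, receptions are independent across users and of the past. A pending request $m$ is satisfied in slot $t$ if $\tau_m\le t<d_m$, page $i_m$ is transmitted to user $u_m$ and user $u_m$ receives it; it then earns non-negative reward $r_{i_m}^{u_m}$, and is removed. Each request earns reward at most once, and the objective is to maximize expected total reward over the horizon. An adaptive policy chooses the page and the set of users in slot $t$ based on the information available up to time $t$. The myopic policy chooses in each slot $t$ a page $i$ and a set of at most $k$ users maximizing the expected reward earned in that slot, i.e. the sum of $P_t^u r_i^u$ over those chosen users $u$ having a pending unexpired request for page $i$. *)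

theory Defs
  imports "HOL-Probability.Probability"
begin

datatype ('u, 'i) request =
  Request (user_of: 'u) (page_of: 'i) (arrival_of: nat) (deadline_of: nat)

text \<open>
  An action is the transmitted page together with the set of users it is transmitted to. One slot
  of a history records the action taken and the set of users who received the transmission; the
  list is in chronological order, so a history of length \<open>t\<close> is what has happened before slot \<open>t\<close>.
\<close>

type_synonym ('u, 'i) action = "'i \<times> 'u set"
type_synonym ('u, 'i) history = "(('u, 'i) action \<times> 'u set) list"

text \<open>
  A policy maps the slot, the history of transmissions and receptions, and the exogenous sample
  point to an action. That only exogenous information available by slot \<open>t\<close> is used is expressed by
  measurability, see \<open>adaptive_policy\<close> below.
\<close>

type_synonym ('w, 'u, 'i) policy = "nat \<Rightarrow> ('u, 'i) history \<Rightarrow> 'w \<Rightarrow> ('u, 'i) action"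

text \<open>
  Slots are \<open>0, \<dots>, T - 1\<close>. The probability space \<open>M\<close> carries the exogenous randomness only:
  \<open>Req t \<omega>\<close> is the set of requests arriving in slot \<open>t\<close>, and \<open>P t u \<omega>\<close> is the probability that
  user \<open>u\<close> receives a transmission in slot \<open>t\<close>. The sigma-algebra \<open>F t\<close> is the exogenous
  information available in slot \<open>t\<close>; any filtration to which the processes are adapted is allowed,
  the one they generate being the smallest choice. Receptions are generated on top of
  \<open>M\<close>, in \<open>reception\<close> and \<open>history_pmf\<close>. The number \<open>k\<close> bounds the users served in a slot, \<open>B\<close> the
  arrivals in a slot.

  By the last axiom a user never requests the same page twice, neither in different slots nor
  within one slot.
\<close>

locale broadcast_scheduling = prob_space M + filtration "space M" F
  for M :: "'w measure" and F :: "nat \<Rightarrow> 'w measure" +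
  fixes T :: nat and k :: nat and B :: nat
    and Req :: "nat \<Rightarrow> 'w \<Rightarrow> ('u::finite, 'i::finite) request set"
    and P :: "nat \<Rightarrow> 'u \<Rightarrow> 'w \<Rightarrow> real"
    and r :: "'u \<Rightarrow> 'i \<Rightarrow> real"
  assumes subalgebra_F: "\<And>t. subalgebra M (F t)"
    and k_ge_1: "k \<ge> 1"
    and reward_nonneg: "\<And>u i. r u i \<ge> 0"
    and P_adapted: "\<And>t u. t < T \<Longrightarrow> P t u \<in> borel_measurable (F t)"
    and P_range: "\<And>t u \<omega>. t < T \<Longrightarrow> \<omega> \<in> space M \<Longrightarrow> P t u \<omega> \<in> {0..1}"
    and Req_adapted: "\<And>t. t < T \<Longrightarrow> Req t \<in> F t \<rightarrow>\<^sub>M count_space UNIV"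
    and Req_bounded: "\<And>t \<omega>. t < T \<Longrightarrow> \<omega> \<in> space M \<Longrightarrow> finite (Req t \<omega>) \<and> card (Req t \<omega>) \<le> B"
    and Req_arrival: "\<And>t \<omega> m. t < T \<Longrightarrow> \<omega> \<in> space M \<Longrightarrow> m \<in> Req t \<omega> \<Longrightarrow> arrival_of m = t"
    and Req_unique: "\<And>s t \<omega> m m'. s \<le> t \<Longrightarrow> t < T \<Longrightarrow> \<omega> \<in> space M \<Longrightarrow>
      m \<in> Req s \<omega> \<Longrightarrow> m' \<in> Req t \<omega> \<Longrightarrow> user_of m = user_of m' \<Longrightarrow> page_of m = page_of m' \<Longrightarrow> m = m'"
begin

definition feasible :: "('u, 'i) action set" where
  "feasible = {(i, S). card S \<le> k}"

definition adaptive_policy :: "('w, 'u, 'i) policy \<Rightarrow> bool" where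
  "adaptive_policy \<pi> \<longleftrightarrow> (\<forall>t<T. \<forall>h. length h = t \<longrightarrow>
     \<pi> t h \<in> F t \<rightarrow>\<^sub>M count_space UNIV \<and> (\<forall>\<omega>\<in>space M. \<pi> t h \<omega> \<in> feasible))"

text \<open>The random set of receivers when a page is transmitted to the users in \<open>S\<close> in slot \<open>t\<close>.\<close>

definition reception :: "nat \<Rightarrow> 'w \<Rightarrow> 'u set \<Rightarrow> 'u set pmf" where
  "reception t \<omega> S =
     map_pmf (\<lambda>f. {u \<in> S. f u}) (Pi_pmf S False (\<lambda>u. bernoulli_pmf (P t u \<omega>)))"

text \<open>The law of the history up to slot \<open>t\<close> under \<open>\<pi>\<close>, conditional on the exogenous processes.\<close>

fun history_pmf :: "('w, 'u, 'i) policy \<Rightarrow> 'w \<Rightarrow> nat \<Rightarrow> ('u, 'i) history pmf" where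
  "history_pmf \<pi> \<omega> 0 = return_pmf []"
| "history_pmf \<pi> \<omega> (Suc t) = bind_pmf (history_pmf \<pi> \<omega> t)
     (\<lambda>h. let (i, S) = \<pi> t h \<omega> in map_pmf (\<lambda>R. h @ [((i, S), R)]) (reception t \<omega> S))"

definition satisfies :: "nat \<Rightarrow> ('u, 'i) action \<times> 'u set \<Rightarrow> ('u, 'i) request \<Rightarrow> bool" where
  "satisfies t x m \<longleftrightarrow> (case x of ((i, S), R) \<Rightarrow>
     arrival_of m \<le> t \<and> t < deadline_of m \<and> page_of m = i \<and> user_of m \<in> S \<and> user_of m \<in> R)"

text \<open>The requests, expired ones included, that have arrived by slot \<open>length h\<close> and are unsatisfied
  after the history \<open>h\<close>.\<close>

definition pending :: "'w \<Rightarrow> ('u, 'i) history \<Rightarrow> ('u, 'i) request set" where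
  "pending \<omega> h =
     {m \<in> (\<Union>s\<le>length h. Req s \<omega>). \<not> (\<exists>s<length h. satisfies s (h ! s) m)}"

definition slot_reward :: "'w \<Rightarrow> ('u, 'i) history \<Rightarrow> ('u, 'i) action \<times> 'u set \<Rightarrow> real" where
  "slot_reward \<omega> h x =
     (\<Sum>m | m \<in> pending \<omega> h \<and> satisfies (length h) x m. r (user_of m) (page_of m))"

definition total_reward :: "'w \<Rightarrow> ('u, 'i) history \<Rightarrow> real" where
  "total_reward \<omega> h = (\<Sum>t<length h. slot_reward \<omega> (take t h) (h ! t))"

definition expected_total_reward :: "('w, 'u, 'i) policy \<Rightarrow> ennreal" where
  "expected_total_reward \<pi> =
     (\<integral>\<^sup>+\<omega>. (\<integral>\<^sup>+h. ennreal (total_reward \<omega> h) \<partial>measure_pmf (history_pmf \<pi> \<omega> T)) \<partial>M)"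

definition optimal_value :: ennreal where
  "optimal_value = (SUP \<pi> \<in> {\<pi>. adaptive_policy \<pi>}. expected_total_reward \<pi>)"

text \<open>The expected reward earned in slot \<open>length h\<close> by an action taken after the history \<open>h\<close>.\<close>

definition myopic_value :: "'w \<Rightarrow> ('u, 'i) history \<Rightarrow> ('u, 'i) action \<Rightarrow> real" where
  "myopic_value \<omega> h a = (case a of (i, S) \<Rightarrow>
     (\<Sum>u | u \<in> S \<and> (\<exists>m\<in>pending \<omega> h. user_of m = u \<and> page_of m = i \<and> length h < deadline_of m).
        P (length h) u \<omega> * r u i))"

text \<open>Ties are broken arbitrarily; the choice matters only after histories that can occur.\<close>

definition myopic_policy :: "('w, 'u, 'i) policy \<Rightarrow> bool" where
  "myopic_policy \<pi> \<longleftrightarrow> adaptive_policy \<pi> \<and>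
     (\<forall>t<T. \<forall>\<omega>\<in>space M. \<forall>h\<in>set_pmf (history_pmf \<pi> \<omega> t). \<forall>a\<in>feasible.
        myopic_value \<omega> h a \<le> myopic_value \<omega> h (\<pi> t h \<omega>))"

end

end

theory Submission
  imports Defs
begin

text \<open>
  The comparison already holds for every fixed sample point \<open>\<omega>\<close> of the exogenous processes, even
  against a policy that knows \<open>\<omega>\<close> in full: whether an action is myopic in slot \<open>t\<close> depends only
  on the current pending requests and on the current reception probabilities. So fix \<open>\<omega>\<close> and run
  the two policies with independent receptions, giving histories \<open>h\<close> (myopic) and \<open>g\<close> (competitor).

  Charge the reward of every request that the competitor serves. Either the myopic policy serves
  that request too, at some time, or the request is still pending for the myopic policy in the
  slot in which the competitor serves it. Hence, for any two histories of the same length,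
  the reward of \<open>g\<close> is at most the reward of \<open>h\<close> plus the sum over all slots \<open>t\<close> of what the
  transmissions of \<open>g\<close> in slot \<open>t\<close> would have earned on the pending requests of \<open>h\<close>
  (\<open>total_reward_le_charged\<close>). Since a user has at most one request per page, the conditional
  expectation of what a transmission earns in slot \<open>t\<close> is its myopic value
  (\<open>nn_integral_slot_reward\<close>). The receptions of \<open>g\<close> in slot \<open>t\<close> are independent of the past of
  \<open>h\<close>, so the expected \<open>t\<close>-th charged term is at most the largest myopic value after \<open>h\<close>, which is the
  expected reward of the myopic policy in slot \<open>t\<close> (\<open>nn_integral_charged_reward_le\<close>). The two parts
  together are bounded by twice the expected reward of the myopic policy; integrating over \<open>\<omega>\<close>
  gives the theorem.
\<close>

lemma sum_UN_le:
  fixes f :: "'a \<Rightarrow> real"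
  assumes "finite I" "\<And>i. i \<in> I \<Longrightarrow> finite (A i)" "\<And>x. f x \<ge> 0"
  shows "sum f (\<Union>i\<in>I. A i) \<le> (\<Sum>i\<in>I. sum f (A i))"
  using assms(1,2)
proof (induction I rule: finite_induct)
  case (insert i I)
  have "sum f (\<Union>j\<in>insert i I. A j) = sum f (A i \<union> (\<Union>j\<in>I. A j))" by simp
  also have "\<dots> \<le> sum f (A i) + sum f (\<Union>j\<in>I. A j)"
    using insert sum_Un[of "A i" "\<Union>j\<in>I. A j" f]
      sum_nonneg[of "A i \<inter> (\<Union>j\<in>I. A j)" f] assms(3) by simp
  also have "\<dots> \<le> sum f (A i) + (\<Sum>j\<in>I. sum f (A j))" using insert by simp
  finally show ?case using insert by simp
qed simp

text \<open>
  The inequality that needs no measurability of the integrand. The expected rewards in question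
  are upper integrals of the conditional expectations given \<open>\<omega>\<close>, and it spares a proof that the
  latter are measurable.
\<close>

lemma mult_nn_integral_le: "c * (\<integral>\<^sup>+x. f x \<partial>N) \<le> (\<integral>\<^sup>+x. c * f x \<partial>N)"
proof -
  have "c * integral\<^sup>S N s \<le> (\<integral>\<^sup>+x. c * f x \<partial>N)" if s: "simple_function N s" "s \<le> f" for s
  proof -
    have "c * integral\<^sup>S N s = (\<integral>\<^sup>+x. c * s x \<partial>N)"
      using s by (simp add: nn_integral_cmult borel_measurable_simple_function
          nn_integral_eq_simple_integral)
    also have "\<dots> \<le> (\<integral>\<^sup>+x. c * f x \<partial>N)"
      using s(2) by (intro nn_integral_mono mult_left_mono) (auto simp: le_fun_def)
    finally show ?thesis .
  qed
  then show ?thesis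
    unfolding nn_integral_def[of N f] SUP_mult_left_ennreal by (intro SUP_least) auto
qed


context broadcast_scheduling
begin

section \<open>Rewards along a pair of histories\<close>

text \<open>The requests that the transmission and receptions \<open>x\<close> would satisfy in the slot following
  the history \<open>h\<close>.\<close>

definition newly_served ::
    "'w \<Rightarrow> ('u, 'i) history \<Rightarrow> ('u, 'i) action \<times> 'u set \<Rightarrow> ('u, 'i) request set" where
  "newly_served \<omega> h x = {m \<in> pending \<omega> h. satisfies (length h) x m}"

text \<open>The requests satisfied in the course of the history \<open>h\<close>. Requests satisfied before their
  arrival do not occur, so all arrivals within the horizon may be admitted.\<close>

definition served :: "'w \<Rightarrow> ('u, 'i) history \<Rightarrow> ('u, 'i) request set" where
  "served \<omega> h = {m \<in> (\<Union>s<T. Req s \<omega>). \<exists>s<length h. satisfies s (h ! s) m}"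

text \<open>The reward that the slots of \<open>g\<close> would have earned on the requests pending along \<open>h\<close>.\<close>

definition charged_reward :: "'w \<Rightarrow> ('u, 'i) history \<Rightarrow> ('u, 'i) history \<Rightarrow> real" where
  "charged_reward \<omega> h g = (\<Sum>t<length g. slot_reward \<omega> (take t h) (g ! t))"

abbreviation request_reward :: "('u, 'i) request \<Rightarrow> real" where
  "request_reward m \<equiv> r (user_of m) (page_of m)"

lemma slot_reward_eq_sum_newly_served: "slot_reward \<omega> h x = sum request_reward (newly_served \<omega> h x)"
  by (simp add: slot_reward_def newly_served_def)

lemma slot_reward_nonneg: "slot_reward \<omega> h x \<ge> 0"
  by (simp add: slot_reward_def reward_nonneg sum_nonneg)

lemma total_reward_nonneg: "total_reward \<omega> h \<ge> 0"
  by (simp add: total_reward_def slot_reward_nonneg sum_nonneg)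

lemma charged_reward_nonneg: "charged_reward \<omega> h g \<ge> 0"
  by (simp add: charged_reward_def slot_reward_nonneg sum_nonneg)

lemma finite_pending:
  assumes "\<omega> \<in> space M" "length h < T"
  shows "finite (pending \<omega> h)"
proof (rule finite_subset)
  show "pending \<omega> h \<subseteq> (\<Union>s\<le>length h. Req s \<omega>)" by (auto simp: pending_def)
  show "finite (\<Union>s\<le>length h. Req s \<omega>)" using assms Req_bounded by auto
qed

lemma finite_newly_served:
  assumes "\<omega> \<in> space M" "length h < T"
  shows "finite (newly_served \<omega> h x)"
  using finite_pending[OF assms] by (simp add: newly_served_def)

lemma finite_served:
  assumes "\<omega> \<in> space M"
  shows "finite (served \<omega> h)"
  using assms Req_bounded by (auto simp: served_def)

lemma newly_served_take_iff:
  assumes "\<omega> \<in> space M" "t < T" "t \<le> length h"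
  shows "m \<in> newly_served \<omega> (take t h) x \<longleftrightarrow>
    m \<in> (\<Union>s<T. Req s \<omega>) \<and> satisfies t x m \<and> \<not> (\<exists>s<t. satisfies s (h ! s) m)"
proof -
  have "m \<in> (\<Union>s\<le>t. Req s \<omega>)" if "m \<in> (\<Union>s<T. Req s \<omega>)" "satisfies t x m"
  proof -
    from that(1) obtain s where s: "s < T" "m \<in> Req s \<omega>" by auto
    with Req_arrival assms(1) have "arrival_of m = s" by blast
    with that(2) have "s \<le> t" by (auto simp: satisfies_def split: prod.splits)
    with s show ?thesis by auto
  qed
  moreover have "m \<in> (\<Union>s<T. Req s \<omega>)" if "m \<in> (\<Union>s\<le>t. Req s \<omega>)"
    using that assms(2) by auto
  ultimately show ?thesis
    using assms(3) by (auto simp: newly_served_def pending_def min_absorb2)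
qed

text \<open>A served request is newly served in exactly one slot, the first one that satisfies it.\<close>

lemma total_reward_eq_sum_served:
  assumes "\<omega> \<in> space M" "length h \<le> T"
  shows "total_reward \<omega> h = sum request_reward (served \<omega> h)"
proof -
  let ?N = "\<lambda>t. newly_served \<omega> (take t h) (h ! t)"
  have N: "m \<in> ?N t \<longleftrightarrow> m \<in> (\<Union>s<T. Req s \<omega>) \<and> satisfies t (h ! t) m \<and>
      \<not> (\<exists>s<t. satisfies s (h ! s) m)" if "t < length h" for m t
    using that assms by (intro newly_served_take_iff) auto
  have "served \<omega> h = (\<Union>t<length h. ?N t)"
  proof (intro equalityI subsetI)
    fix m assume "m \<in> served \<omega> h"
    then have m: "m \<in> (\<Union>s<T. Req s \<omega>)" "\<exists>s. s < length h \<and> satisfies s (h ! s) m"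
      by (auto simp: served_def)
    from m(2) obtain t where t: "t < length h \<and> satisfies t (h ! t) m"
      "\<And>s. s < t \<Longrightarrow> \<not> (s < length h \<and> satisfies s (h ! s) m)"
      using exists_least_iff[of "\<lambda>s. s < length h \<and> satisfies s (h ! s) m"] by blast
    then have "m \<in> ?N t" using m(1) N[of t m] by auto
    with t show "m \<in> (\<Union>t<length h. ?N t)" by auto
  next
    fix m assume "m \<in> (\<Union>t<length h. ?N t)"
    then obtain t where "t < length h" "m \<in> ?N t" by auto
    with N[of t m] show "m \<in> served \<omega> h" by (auto simp: served_def)
  qed
  moreover have "?N s \<inter> ?N t = {}" if "s < length h" "t < length h" "s \<noteq> t" for s t
  proof -
    have "\<not> (m \<in> ?N s \<and> m \<in> ?N t)" for m
      unfolding N[OF that(1)] N[OF that(2)] using that(3) by (meson nat_neq_iff)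
    then show ?thesis by auto
  qed
  ultimately have "sum request_reward (served \<omega> h) =
      (\<Sum>t<length h. sum request_reward (?N t))"
    using assms by (simp only:) (intro sum.UNION_disjoint, auto intro!: finite_newly_served)
  then show ?thesis by (simp add: total_reward_def slot_reward_eq_sum_newly_served)
qed

lemma total_reward_le_charged:
  assumes \<omega>: "\<omega> \<in> space M" and len: "length h = length g" "length g \<le> T"
  shows "total_reward \<omega> g \<le> total_reward \<omega> h + charged_reward \<omega> h g"
proof -
  let ?N = "\<lambda>t. newly_served \<omega> (take t h) (g ! t)"
  have fin: "finite (?N t)" if "t < length g" for t
    using that assms by (intro finite_newly_served) auto
  have sub: "served \<omega> g \<subseteq> served \<omega> h \<union> (\<Union>t<length g. ?N t)"
  proof
    fix m assume "m \<in> served \<omega> g"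
    then obtain t where t: "m \<in> (\<Union>s<T. Req s \<omega>)" "t < length g" "satisfies t (g ! t) m"
      by (auto simp: served_def)
    show "m \<in> served \<omega> h \<union> (\<Union>t<length g. ?N t)"
    proof (cases "\<exists>s<t. satisfies s (h ! s) m")
      case True
      then have "m \<in> served \<omega> h"
        using t len unfolding served_def by (auto intro: less_trans)
      then show ?thesis by simp
    next
      case False
      then have "m \<in> ?N t"
        using t len \<omega> by (subst newly_served_take_iff) auto
      then show ?thesis using t by auto
    qed
  qed
  have "sum request_reward (served \<omega> g)
      \<le> sum request_reward (served \<omega> h \<union> (\<Union>t<length g. ?N t))"
    using fin by (intro sum_mono2 sub) (auto simp: finite_served[OF \<omega>] reward_nonneg)
  also have "\<dots> \<le> sum request_reward (served \<omega> h) + sum request_reward (\<Union>t<length g. ?N t)"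
    using fin by (subst sum_Un) (auto simp: finite_served[OF \<omega>] reward_nonneg sum_nonneg)
  also have "\<dots> \<le> sum request_reward (served \<omega> h) + (\<Sum>t<length g. sum request_reward (?N t))"
    using fin by (intro add_left_mono sum_UN_le) (auto simp: reward_nonneg)
  finally show ?thesis
    using assms by (simp add: total_reward_eq_sum_served charged_reward_def
        slot_reward_eq_sum_newly_served)
qed

section \<open>The expected reward of one slot\<close>

text \<open>By uniqueness of the request of a user for a page, the reward of a slot may be summed over
  users instead of requests.\<close>

lemma slot_reward_eq_sum_users:
  assumes \<omega>: "\<omega> \<in> space M" and len: "length h < T"
  shows "slot_reward \<omega> h ((i, S), R) =
    (\<Sum>u | u \<in> S \<and> (\<exists>m\<in>pending \<omega> h. user_of m = u \<and> page_of m = i \<and> length h < deadline_of m).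
       r u i * indicator R u)"
    (is "_ = sum _ ?U")
proof -
  let ?N = "newly_served \<omega> h ((i, S), R)"
  have inj: "inj_on user_of ?N"
  proof (rule inj_onI)
    fix m m' assume mm': "m \<in> ?N" "m' \<in> ?N" and user: "user_of m = user_of m'"
    from mm' have page: "page_of m = page_of m'"
      by (auto simp: newly_served_def satisfies_def)
    from mm' obtain s s' where s: "s \<le> length h" "m \<in> Req s \<omega>" "s' \<le> length h" "m' \<in> Req s' \<omega>"
      by (auto simp: newly_served_def pending_def)
    show "m = m'"
    proof (cases "s \<le> s'")
      case True
      then show ?thesis using Req_unique[of s s' \<omega> m m'] s len \<omega> user page by auto
    next
      case False
      then show ?thesis using Req_unique[of s' s \<omega> m' m] s len \<omega> user page by auto
    qed
  qed
  have arrival: "arrival_of m \<le> length h" if m: "m \<in> pending \<omega> h" for m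
  proof -
    from m obtain s where s: "s \<le> length h" "m \<in> Req s \<omega>" by (auto simp: pending_def)
    with Req_arrival[of s \<omega> m] \<omega> len show ?thesis by simp
  qed
  have img: "user_of ` ?N = ?U \<inter> R"
    using arrival by (auto simp: newly_served_def satisfies_def image_iff)
  have "slot_reward \<omega> h ((i, S), R) = (\<Sum>m\<in>?N. r (user_of m) i)"
    unfolding slot_reward_eq_sum_newly_served
    by (intro sum.cong) (auto simp: newly_served_def satisfies_def)
  also have "\<dots> = (\<Sum>u\<in>user_of ` ?N. r u i)"
    using inj by (simp add: sum.reindex)
  also have "\<dots> = (\<Sum>u\<in>?U. r u i * indicator R u)"
    unfolding img by (simp add: sum.inter_restrict indicator_def of_bool_def if_distrib cong: if_cong)
  finally show ?thesis .
qed

lemma nn_integral_reception_indicator: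
  assumes "\<omega> \<in> space M" "t < T" "u \<in> S"
  shows "(\<integral>\<^sup>+R. indicator R u \<partial>measure_pmf (reception t \<omega> S)) = ennreal (P t u \<omega>)"
proof -
  let ?\<mu> = "Pi_pmf S False (\<lambda>u. bernoulli_pmf (P t u \<omega>))"
  have "(\<integral>\<^sup>+R. indicator R u \<partial>measure_pmf (reception t \<omega> S))
      = (\<integral>\<^sup>+f. indicator {True} (f u) \<partial>measure_pmf ?\<mu>)"
    using assms(3) by (auto simp: reception_def indicator_def intro!: nn_integral_cong)
  also have "\<dots> = (\<integral>\<^sup>+b. indicator {True} b \<partial>measure_pmf (map_pmf (\<lambda>f. f u) ?\<mu>))"
    by simp
  also have "map_pmf (\<lambda>f. f u) ?\<mu> = bernoulli_pmf (P t u \<omega>)"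
    using assms(3) by (simp add: Pi_pmf_component)
  also have "(\<integral>\<^sup>+b. indicator {True} b \<partial>measure_pmf (bernoulli_pmf (P t u \<omega>))) = ennreal (P t u \<omega>)"
    using P_range[OF assms(2,1), of u] by (subst nn_integral_bernoulli_pmf) auto
  finally show ?thesis .
qed

lemma nn_integral_slot_reward:
  assumes \<omega>: "\<omega> \<in> space M" and len: "length h = t" "t < T"
  shows "(\<integral>\<^sup>+R. ennreal (slot_reward \<omega> h ((i, S), R)) \<partial>measure_pmf (reception t \<omega> S))
    = ennreal (myopic_value \<omega> h (i, S))"
proof -
  let ?U = "{u. u \<in> S \<and> (\<exists>m\<in>pending \<omega> h. user_of m = u \<and> page_of m = i \<and> length h < deadline_of m)}"
  have "ennreal (slot_reward \<omega> h ((i, S), R)) = (\<Sum>u\<in>?U. ennreal (r u i) * indicator R u)" for R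
    using len \<omega> by (subst slot_reward_eq_sum_users)
      (auto simp: reward_nonneg ennreal_mult ennreal_indicator simp flip: sum_ennreal)
  then have "(\<integral>\<^sup>+R. ennreal (slot_reward \<omega> h ((i, S), R)) \<partial>measure_pmf (reception t \<omega> S))
      = (\<Sum>u\<in>?U. ennreal (r u i) * (\<integral>\<^sup>+R. indicator R u \<partial>measure_pmf (reception t \<omega> S)))"
    by (simp only:) (subst nn_integral_sum, auto simp: nn_integral_cmult)
  also have "\<dots> = (\<Sum>u\<in>?U. ennreal (P t u \<omega> * r u i))"
    using P_range[OF len(2) \<omega>]
    by (intro sum.cong refl)
      (simp add: nn_integral_reception_indicator \<omega> len(2) ennreal_mult reward_nonneg mult.commute)
  also have "\<dots> = ennreal (myopic_value \<omega> h (i, S))"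
    using P_range[OF len(2) \<omega>] len(1)
    by (subst sum_ennreal) (auto simp: myopic_value_def reward_nonneg)
  finally show ?thesis .
qed

section \<open>The comparison for a fixed sample point\<close>

lemma length_history: "h \<in> set_pmf (history_pmf \<pi> \<omega> t) \<Longrightarrow> length h = t"
  by (induction t arbitrary: h) (auto simp: split_beta Let_def)

lemma nn_integral_history_Suc:
  "(\<integral>\<^sup>+h. f h \<partial>measure_pmf (history_pmf \<pi> \<omega> (Suc t))) =
   (\<integral>\<^sup>+h. (\<integral>\<^sup>+R. f (h @ [(\<pi> t h \<omega>, R)]) \<partial>measure_pmf (reception t \<omega> (snd (\<pi> t h \<omega>))))
      \<partial>measure_pmf (history_pmf \<pi> \<omega> t))"
  by (auto simp: split_beta Let_def intro!: nn_integral_cong)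

lemma total_reward_snoc: "total_reward \<omega> (h @ [x]) = total_reward \<omega> h + slot_reward \<omega> h x"
  by (simp add: total_reward_def nth_append)

lemma charged_reward_snoc:
  assumes "length h = length g"
  shows "charged_reward \<omega> (h @ [y]) (g @ [x]) = charged_reward \<omega> h g + slot_reward \<omega> h x"
  using assms by (simp add: charged_reward_def nth_append)

lemma nn_integral_total_reward_Suc:
  assumes \<omega>: "\<omega> \<in> space M" and t: "t < T"
  shows "(\<integral>\<^sup>+h. ennreal (total_reward \<omega> h) \<partial>measure_pmf (history_pmf \<pi> \<omega> (Suc t))) =
    (\<integral>\<^sup>+h. ennreal (total_reward \<omega> h) \<partial>measure_pmf (history_pmf \<pi> \<omega> t)) +
    (\<integral>\<^sup>+h. ennreal (myopic_value \<omega> h (\<pi> t h \<omega>)) \<partial>measure_pmf (history_pmf \<pi> \<omega> t))"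
proof -
  have "(\<integral>\<^sup>+h. ennreal (total_reward \<omega> h) \<partial>measure_pmf (history_pmf \<pi> \<omega> (Suc t))) =
    (\<integral>\<^sup>+h. ennreal (total_reward \<omega> h) + ennreal (myopic_value \<omega> h (\<pi> t h \<omega>))
       \<partial>measure_pmf (history_pmf \<pi> \<omega> t))"
    unfolding nn_integral_history_Suc
  proof (intro nn_integral_cong_AE AE_pmfI)
    fix h assume "h \<in> set_pmf (history_pmf \<pi> \<omega> t)"
    then have "length h = t" by (rule length_history)
    then show "(\<integral>\<^sup>+R. ennreal (total_reward \<omega> (h @ [(\<pi> t h \<omega>, R)]))
          \<partial>measure_pmf (reception t \<omega> (snd (\<pi> t h \<omega>)))) =
        ennreal (total_reward \<omega> h) + ennreal (myopic_value \<omega> h (\<pi> t h \<omega>))"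
      using nn_integral_slot_reward[OF \<omega> _ t, where h = h and i = "fst (\<pi> t h \<omega>)" and S = "snd (\<pi> t h \<omega>)"]
      by (simp add: total_reward_snoc total_reward_nonneg slot_reward_nonneg nn_integral_add
          measure_pmf.emeasure_space_1)
  qed
  then show ?thesis by (simp add: nn_integral_add)
qed

text \<open>The nested integrals say that \<open>h\<close> and \<open>g\<close> are independent given the exogenous processes.\<close>

lemma nn_integral_charged_reward_le:
  assumes \<omega>: "\<omega> \<in> space M" and \<pi>: "myopic_policy \<pi>" and \<sigma>: "adaptive_policy \<sigma>" and "t \<le> T"
  shows "(\<integral>\<^sup>+h. (\<integral>\<^sup>+g. ennreal (charged_reward \<omega> h g) \<partial>measure_pmf (history_pmf \<sigma> \<omega> t))
      \<partial>measure_pmf (history_pmf \<pi> \<omega> t))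
    \<le> (\<integral>\<^sup>+h. ennreal (total_reward \<omega> h) \<partial>measure_pmf (history_pmf \<pi> \<omega> t))"
  using \<open>t \<le> T\<close>
proof (induction t)
  case 0
  then show ?case by (simp add: charged_reward_def)
next
  case (Suc t)
  then have t: "t < T" by simp
  let ?H = "measure_pmf (history_pmf \<pi> \<omega> t)" and ?G = "measure_pmf (history_pmf \<sigma> \<omega> t)"
  have slot: "(\<integral>\<^sup>+R'. ennreal (charged_reward \<omega> (h @ [(\<pi> t h \<omega>, R)]) (g @ [(\<sigma> t g \<omega>, R')]))
        \<partial>measure_pmf (reception t \<omega> (snd (\<sigma> t g \<omega>))))
      \<le> ennreal (charged_reward \<omega> h g) + ennreal (myopic_value \<omega> h (\<pi> t h \<omega>))"
    if h: "h \<in> set_pmf (history_pmf \<pi> \<omega> t)" and g: "g \<in> set_pmf (history_pmf \<sigma> \<omega> t)" for h g R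
  proof -
    have len: "length h = t" "length g = t" using h g length_history by auto
    have "(\<integral>\<^sup>+R'. ennreal (charged_reward \<omega> (h @ [(\<pi> t h \<omega>, R)]) (g @ [(\<sigma> t g \<omega>, R')]))
        \<partial>measure_pmf (reception t \<omega> (snd (\<sigma> t g \<omega>))))
      = ennreal (charged_reward \<omega> h g) + ennreal (myopic_value \<omega> h (\<sigma> t g \<omega>))"
      using nn_integral_slot_reward[OF \<omega> len(1) t, where i = "fst (\<sigma> t g \<omega>)" and S = "snd (\<sigma> t g \<omega>)"] len
      by (simp add: charged_reward_snoc charged_reward_nonneg slot_reward_nonneg nn_integral_add
          measure_pmf.emeasure_space_1)
    moreover have "\<sigma> t g \<omega> \<in> feasible"
      using \<sigma> t len(2) \<omega> by (auto simp: adaptive_policy_def)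
    then have "myopic_value \<omega> h (\<sigma> t g \<omega>) \<le> myopic_value \<omega> h (\<pi> t h \<omega>)"
      using \<pi> t \<omega> h unfolding myopic_policy_def by blast
    ultimately show ?thesis by (simp add: add_left_mono ennreal_leI)
  qed
  have "(\<integral>\<^sup>+h. (\<integral>\<^sup>+g. ennreal (charged_reward \<omega> h g) \<partial>measure_pmf (history_pmf \<sigma> \<omega> (Suc t)))
      \<partial>measure_pmf (history_pmf \<pi> \<omega> (Suc t)))
    \<le> (\<integral>\<^sup>+h. (\<integral>\<^sup>+R. (\<integral>\<^sup>+g. ennreal (charged_reward \<omega> h g) +
          ennreal (myopic_value \<omega> h (\<pi> t h \<omega>)) \<partial>?G)
        \<partial>measure_pmf (reception t \<omega> (snd (\<pi> t h \<omega>)))) \<partial>?H)"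
    unfolding nn_integral_history_Suc
    by (intro nn_integral_mono_AE AE_pmfI slot)
  also have "\<dots> = (\<integral>\<^sup>+h. (\<integral>\<^sup>+g. ennreal (charged_reward \<omega> h g) \<partial>?G) \<partial>?H) +
      (\<integral>\<^sup>+h. ennreal (myopic_value \<omega> h (\<pi> t h \<omega>)) \<partial>?H)"
    by (simp add: nn_integral_add measure_pmf.emeasure_space_1)
  also have "\<dots> \<le> (\<integral>\<^sup>+h. ennreal (total_reward \<omega> h) \<partial>?H) +
      (\<integral>\<^sup>+h. ennreal (myopic_value \<omega> h (\<pi> t h \<omega>)) \<partial>?H)"
    using Suc by (intro add_right_mono) simp
  also have "\<dots> = (\<integral>\<^sup>+h. ennreal (total_reward \<omega> h) \<partial>measure_pmf (history_pmf \<pi> \<omega> (Suc t)))"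
    using nn_integral_total_reward_Suc[OF \<omega> t] by simp
  finally show ?case .
qed

lemma conditional_reward_le_twice_myopic:
  assumes \<omega>: "\<omega> \<in> space M" and \<pi>: "myopic_policy \<pi>" and \<sigma>: "adaptive_policy \<sigma>"
  shows "(\<integral>\<^sup>+g. ennreal (total_reward \<omega> g) \<partial>measure_pmf (history_pmf \<sigma> \<omega> T))
    \<le> 2 * (\<integral>\<^sup>+h. ennreal (total_reward \<omega> h) \<partial>measure_pmf (history_pmf \<pi> \<omega> T))"
proof -
  let ?H = "measure_pmf (history_pmf \<pi> \<omega> T)" and ?G = "measure_pmf (history_pmf \<sigma> \<omega> T)"
  have "(\<integral>\<^sup>+g. ennreal (total_reward \<omega> g) \<partial>?G)
      = (\<integral>\<^sup>+h. (\<integral>\<^sup>+g. ennreal (total_reward \<omega> g) \<partial>?G) \<partial>?H)"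
    by (simp add: measure_pmf.emeasure_space_1)
  also have "\<dots> \<le> (\<integral>\<^sup>+h. (\<integral>\<^sup>+g. ennreal (total_reward \<omega> h) + ennreal (charged_reward \<omega> h g) \<partial>?G) \<partial>?H)"
  proof (intro nn_integral_mono_AE AE_pmfI)
    fix h g assume "h \<in> set_pmf (history_pmf \<pi> \<omega> T)" "g \<in> set_pmf (history_pmf \<sigma> \<omega> T)"
    then have "length h = T" "length g = T" using length_history by auto
    then have "total_reward \<omega> g \<le> total_reward \<omega> h + charged_reward \<omega> h g"
      using total_reward_le_charged[OF \<omega>] by simp
    then show "ennreal (total_reward \<omega> g)
        \<le> ennreal (total_reward \<omega> h) + ennreal (charged_reward \<omega> h g)"
      by (simp add: ennreal_leI total_reward_nonneg charged_reward_nonneg flip: ennreal_plus)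
  qed
  also have "\<dots> = (\<integral>\<^sup>+h. ennreal (total_reward \<omega> h) \<partial>?H) +
      (\<integral>\<^sup>+h. (\<integral>\<^sup>+g. ennreal (charged_reward \<omega> h g) \<partial>?G) \<partial>?H)"
    by (simp add: nn_integral_add measure_pmf.emeasure_space_1)
  also have "\<dots> \<le> (\<integral>\<^sup>+h. ennreal (total_reward \<omega> h) \<partial>?H) + (\<integral>\<^sup>+h. ennreal (total_reward \<omega> h) \<partial>?H)"
    using nn_integral_charged_reward_le[OF \<omega> \<pi> \<sigma>, of T] by (intro add_left_mono) simp
  finally show ?thesis by (simp add: mult_2)
qed

lemma half_expected_reward_le_myopic:
  assumes \<pi>: "myopic_policy \<pi>" and \<sigma>: "adaptive_policy \<sigma>"
  shows "expected_total_reward \<sigma> / 2 \<le> expected_total_reward \<pi>"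
proof -
  let ?V = "\<lambda>\<sigma> \<omega>. \<integral>\<^sup>+h. ennreal (total_reward \<omega> h) \<partial>measure_pmf (history_pmf \<sigma> \<omega> T)"
  have half: "inverse 2 * ?V \<sigma> \<omega> \<le> ?V \<pi> \<omega>" if \<omega>: "\<omega> \<in> space M" for \<omega>
  proof -
    have "inverse 2 * ?V \<sigma> \<omega> \<le> inverse 2 * (2 * ?V \<pi> \<omega>)"
      using conditional_reward_le_twice_myopic[OF \<omega> \<pi> \<sigma>] by (intro mult_left_mono) auto
    also have "\<dots> = (2 * inverse 2) * ?V \<pi> \<omega>"
      by (simp only: ac_simps)
    also have "\<dots> = ?V \<pi> \<omega>"
      by (simp add: ennreal_divide_self flip: divide_ennreal_def)
    finally show ?thesis .
  qed
  have "expected_total_reward \<sigma> / 2 = inverse 2 * (\<integral>\<^sup>+\<omega>. ?V \<sigma> \<omega> \<partial>M)"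
    by (simp add: expected_total_reward_def divide_ennreal_def mult.commute)
  also have "\<dots> \<le> (\<integral>\<^sup>+\<omega>. inverse 2 * ?V \<sigma> \<omega> \<partial>M)"
    by (rule mult_nn_integral_le)
  also have "\<dots> \<le> (\<integral>\<^sup>+\<omega>. ?V \<pi> \<omega> \<partial>M)"
    by (intro nn_integral_mono half)
  finally show ?thesis by (simp add: expected_total_reward_def)
qed

end

theorem mainTheorem11:
  fixes M :: "'w measure" and F :: "nat \<Rightarrow> 'w measure"
    and T k B :: nat
    and Req :: "nat \<Rightarrow> 'w \<Rightarrow> ('u::finite, 'i::finite) request set"
    and P :: "nat \<Rightarrow> 'u \<Rightarrow> 'w \<Rightarrow> real"
    and r :: "'u \<Rightarrow> 'i \<Rightarrow> real"
    and \<pi> :: "('w, 'u, 'i) policy"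
  assumes "broadcast_scheduling M F T k B Req P r"
    and "broadcast_scheduling.myopic_policy M F T k Req P r \<pi>"
  shows "broadcast_scheduling.expected_total_reward M T Req P r \<pi>
         \<ge> broadcast_scheduling.optimal_value M F T k Req P r / 2"
proof -
  interpret broadcast_scheduling M F T k B Req P r by (fact assms(1))
  show ?thesis
    using half_expected_reward_le_myopic[OF assms(2)]
    unfolding optimal_value_def SUP_divide_ennreal by (intro SUP_least) auto
qed

end
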